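(* Let $X$ be a countably compact Urysohn topological space with $|X| < 2^{\aleph_0}$. Then $X$ is weakly Whyburn.
   Context: A space $X$ is Urysohn if for every pair of points $x \neq y$ of $X$ there are open neighbourhoods $U$ of $x$ and $V$ of $y$ such that $\overline{U} \cap \overline{V} = \emptyset$ (in particular $X$ is Hausdorff). A space is countably compact if every countable open cover has a finite subcover. Given a space $X$, a set $B \subset X$ is an almost closed set converging to $x$ if $\overline{B} \setminus B = \{x\}$. A space $X$ is weakly Whyburn if for every non-closed set $A \subset X$ there is an almost closed set $B \subset A$ which converges to a point outside of $A$; equivalently, for every non-closed $A \subset X$ there is $B \subset A$ such that $\overline{B} \setminus A$ is a singleton. *)

theory Defs
  imports "HOL-Analysis.Analysis" "HOL-Library.Equipollence"
begin

definition Urysohn_space :: "'a topology \<Rightarrow> bool" where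
  "Urysohn_space X \<longleftrightarrow>
     (\<forall>x y. x \<in> topspace X \<and> y \<in> topspace X \<and> x \<noteq> y \<longrightarrow>
        (\<exists>U V. openin X U \<and> openin X V \<and> x \<in> U \<and> y \<in> V \<and>
               (X closure_of U) \<inter> (X closure_of V) = {}))"

lemma Urysohn_imp_Hausdorff_space:
  assumes "Urysohn_space X"
  shows "Hausdorff_space X"
  unfolding Hausdorff_space_def
proof (intro allI impI)
  fix x y
  assume "x \<in> topspace X \<and> y \<in> topspace X \<and> x \<noteq> y"
  then obtain U V where UV: "openin X U" "openin X V" "x \<in> U" "y \<in> V"
      "(X closure_of U) \<inter> (X closure_of V) = {}"
    using assms unfolding Urysohn_space_def by metis
  have "U \<subseteq> X closure_of U" "V \<subseteq> X closure_of V"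
    using UV by (auto intro!: closure_of_subset openin_subset)
  with UV show "\<exists>U V. openin X U \<and> openin X V \<and> x \<in> U \<and> y \<in> V \<and> disjnt U V"
    unfolding disjnt_def by (intro exI[of _ U] exI[of _ V]) auto
qed

text \<open>Abstract-topology counterpart of the library's \<open>countably_compact\<close>, which is
  available only for sets in a type of class \<open>topological_space\<close>.\<close>

definition countably_compact_space :: "'a topology \<Rightarrow> bool" where
  "countably_compact_space X \<longleftrightarrow>
     (\<forall>\<U>. countable \<U> \<and> (\<forall>U\<in>\<U>. openin X U) \<and> topspace X \<subseteq> \<Union>\<U> \<longrightarrow>
        (\<exists>\<F>. finite \<F> \<and> \<F> \<subseteq> \<U> \<and> topspace X \<subseteq> \<Union>\<F>))"

lemma countably_compact_space_euclidean:
  "countably_compact_space (euclidean :: 'a::topological_space topology) \<longleftrightarrow>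
   countably_compact (UNIV :: 'a set)"
  by (simp add: countably_compact_space_def countably_compact_def conj_ac imp_conjL)

definition almost_closed_converging :: "'a topology \<Rightarrow> 'a set \<Rightarrow> 'a \<Rightarrow> bool" where
  "almost_closed_converging X B x \<longleftrightarrow> B \<subseteq> topspace X \<and> (X closure_of B) - B = {x}"

definition weakly_Whyburn_space :: "'a topology \<Rightarrow> bool" where
  "weakly_Whyburn_space X \<longleftrightarrow>
     (\<forall>A. A \<subseteq> topspace X \<and> \<not> closedin X A \<longrightarrow>
        (\<exists>B x. B \<subseteq> A \<and> x \<notin> A \<and> almost_closed_converging X B x))"

lemma weakly_Whyburn_space_alt:
  "weakly_Whyburn_space X \<longleftrightarrow>
     (\<forall>A. A \<subseteq> topspace X \<and> \<not> closedin X A \<longrightarrow>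
        (\<exists>B. B \<subseteq> A \<and> (\<exists>x. (X closure_of B) - A = {x})))"
proof -
  have "(\<exists>B x. B \<subseteq> A \<and> x \<notin> A \<and> almost_closed_converging X B x) \<longleftrightarrow>
        (\<exists>B. B \<subseteq> A \<and> (\<exists>x. (X closure_of B) - A = {x}))" if A: "A \<subseteq> topspace X" for A
  proof
    assume "\<exists>B x. B \<subseteq> A \<and> x \<notin> A \<and> almost_closed_converging X B x"
    then obtain B x where B: "B \<subseteq> A" "x \<notin> A" "(X closure_of B) - B = {x}"
      unfolding almost_closed_converging_def by auto
    hence "(X closure_of B) - A = {x}" by auto
    with B show "\<exists>B. B \<subseteq> A \<and> (\<exists>x. (X closure_of B) - A = {x})"
      by (intro exI[of _ B] conjI exI[of _ x])
  next
    assume "\<exists>B. B \<subseteq> A \<and> (\<exists>x. (X closure_of B) - A = {x})"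
    then obtain B x where B: "B \<subseteq> A" and x: "(X closure_of B) - A = {x}" by blast
    define C where "C = (X closure_of B) \<inter> A"
    have "B \<subseteq> topspace X" using B A by (rule subset_trans)
    hence "B \<subseteq> X closure_of B" by (rule closure_of_subset)
    hence "B \<subseteq> C" using B unfolding C_def by simp
    hence "X closure_of B \<subseteq> X closure_of C" by (rule closure_of_mono)
    moreover have "X closure_of C \<subseteq> X closure_of B"
      by (rule closure_of_minimal) (auto simp: C_def)
    ultimately have "X closure_of C = X closure_of B" by simp
    moreover have "(X closure_of B) - C = (X closure_of B) - A" unfolding C_def by auto
    ultimately have "(X closure_of C) - C = {x}" using x by simp
    moreover have "C \<subseteq> A" unfolding C_def by simp
    moreover have "x \<notin> A" using x by auto
    ultimately show "\<exists>B x. B \<subseteq> A \<and> x \<notin> A \<and> almost_closed_converging X B x"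
      using A unfolding almost_closed_converging_def
      by (intro exI[of _ C] exI[of _ x]) simp
  qed
  thus ?thesis unfolding weakly_Whyburn_space_def by (simp cong: conj_cong)
qed

end

theory Submission
  imports Defs
begin

text \<open>Suppose no almost closed subset of a non-closed set \<open>A\<close> converges to a point outside \<open>A\<close>.
  Then every \<open>B \<subseteq> A\<close> whose closure leaves \<open>A\<close> has two limit points outside \<open>A\<close>; intersecting \<open>B\<close>
  with neighbourhoods of these points that have disjoint closures gives two subsets of the same
  kind with disjoint closures. Iterating from \<open>A\<close> yields a Cantor scheme, and countable
  compactness puts a point on each of its \<open>2\<^sup>\<aleph>\<^sup>0\<close> branches, so \<open>X\<close> has at least \<open>2\<^sup>\<aleph>\<^sup>0\<close> points.\<close>

text \<open>If the intersection were empty, the complements of the \<open>C n\<close> would form a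
  countable open cover. The indices of a finite subcover are bounded by some \<open>m\<close>, and a
  point of \<open>C m\<close> then lies in every \<open>C n\<close> with such an index, so it is
  left uncovered.\<close>

lemma countably_compact_space_decseq_nonempty:
  fixes C :: "nat \<Rightarrow> 'a set"
  assumes "countably_compact_space X" "\<And>n. closedin X (C n)" "\<And>n. C n \<noteq> {}" "decseq C"
  shows "(\<Inter>n. C n) \<noteq> {}"
proof
  assume empty: "(\<Inter>n. C n) = {}"
  let ?U = "range (\<lambda>n. topspace X - C n)"
  have "\<forall>U\<in>?U. openin X U" using assms(2) by blast
  moreover have "topspace X \<subseteq> \<Union>?U" using empty by auto
  moreover have "countable ?U" by simp
  ultimately obtain F where F: "finite F" "F \<subseteq> ?U" "topspace X \<subseteq> \<Union>F"
    using assms(1) unfolding countably_compact_space_def by meson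
  obtain N where N: "finite N" "F = (\<lambda>n. topspace X - C n) ` N"
    using finite_subset_image[OF F(1,2)] by blast
  obtain m where m: "\<And>n. n \<in> N \<Longrightarrow> n \<le> m"
    using N(1) unfolding finite_nat_set_iff_bounded_le by blast
  obtain x where x: "x \<in> C m" using assms(3) by blast
  then have "x \<in> C n" if "n \<in> N" for n
    using decseqD[OF assms(4) m[OF that]] by blast
  moreover have "x \<in> topspace X" using x closedin_subset[OF assms(2)[of m]] by blast
  ultimately show False using F(3) N(2) by blast
qed

text \<open>A set \<open>S\<close> of naturals encodes a branch of the scheme: the half taken at
  stage \<open>n\<close> is \<open>g (n \<in> S)\<close>. The invariant \<open>P\<close> lets the
  splitting go on forever.\<close>

lemma cantor_scheme_lepoll:
  fixes g :: "bool \<Rightarrow> 'a set \<Rightarrow> 'a set"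
  assumes X: "countably_compact_space X"
    and init: "P A"
    and sub: "\<And>B. P B \<Longrightarrow> B \<subseteq> topspace X \<and> B \<noteq> {}"
    and step: "\<And>i B. P B \<Longrightarrow> P (g i B) \<and> g i B \<subseteq> B"
    and disj: "\<And>B. P B \<Longrightarrow> X closure_of g True B \<inter> X closure_of g False B = {}"
  shows "(UNIV :: nat set set) \<lesssim> topspace X"
proof -
  define T where "T S = rec_nat A (\<lambda>n. g (n \<in> S))" for S
  have T_0: "T S 0 = A" and T_Suc: "T S (Suc n) = g (n \<in> S) (T S n)" for S n
    by (simp_all add: T_def)
  have P: "P (T S n)" for S n
    by (induction n) (simp_all add: T_0 T_Suc init step)
  have dec: "decseq (\<lambda>n. X closure_of T S n)" for S
    unfolding decseq_Suc_iff T_Suc using step[OF P] by (simp add: closure_of_mono)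
  have nonempty: "X closure_of T S n \<noteq> {}" for S n
    using sub[OF P[of S n]] closure_of_subset by blast
  have "\<exists>x. \<forall>n. x \<in> X closure_of T S n" for S
    using countably_compact_space_decseq_nonempty[OF X _ nonempty dec[of S]] by auto
  then obtain p where p: "\<And>S n. p S \<in> X closure_of T S n" by metis
  \<comment> \<open>Stage \<open>n\<close> uses only membership of numbers below \<open>n\<close>.
    At the least \<open>n\<close> where \<open>S\<close> and \<open>S'\<close> differ, the branches
    therefore take the two halves of one common set.\<close>
  have agree: "T S n = T S' n" if "\<forall>m<n. m \<in> S \<longleftrightarrow> m \<in> S'" for S S' n
    using that by (induction n) (simp_all add: T_0 T_Suc)
  have "inj p"
  proof (rule injI, rule ccontr)
    fix S S' assume eq: "p S = p S'" and "S \<noteq> S'"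
    then have "\<exists>n. n \<in> S \<longleftrightarrow> n \<notin> S'" by blast
    then obtain n where n: "n \<in> S \<longleftrightarrow> n \<notin> S'" and "\<forall>m<n. m \<in> S \<longleftrightarrow> m \<in> S'"
      using exists_least_iff[of "\<lambda>n. n \<in> S \<longleftrightarrow> n \<notin> S'"] by blast
    then have "T S n = T S' n" using agree by blast
    then have "p S \<in> X closure_of g (n \<in> S) (T S n)" "p S \<in> X closure_of g (n \<in> S') (T S n)"
      using p[of S "Suc n"] p[of S' "Suc n"] eq by (simp_all add: T_Suc)
    then show False using n disj[OF P[of S n]] by (cases "n \<in> S") auto
  qed
  moreover have "range p \<subseteq> topspace X"
    using p closure_of_subset_topspace by fastforce
  ultimately show ?thesis unfolding lepoll_def by blast
qed

text \<open>Intersecting \<open>B\<close> with an open neighbourhood of one of its closure points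
  keeps that point in the closure, and disjointness of the closures passes from \<open>U\<close> and
  \<open>V\<close> to the smaller sets.\<close>

lemma Urysohn_space_split:
  assumes "Urysohn_space X" "x \<in> X closure_of B" "y \<in> X closure_of B" "x \<noteq> y"
  obtains U V where "x \<in> X closure_of (B \<inter> U)" "y \<in> X closure_of (B \<inter> V)"
    "X closure_of (B \<inter> U) \<inter> X closure_of (B \<inter> V) = {}"
proof -
  have "x \<in> topspace X" "y \<in> topspace X"
    using assms(2,3) closure_of_subset_topspace[of X B] by auto
  then obtain U V where UV: "openin X U" "openin X V" "x \<in> U" "y \<in> V"
    "X closure_of U \<inter> X closure_of V = {}"
    using assms(1,4) unfolding Urysohn_space_def by metis
  show thesis
  proof
    show "x \<in> X closure_of (B \<inter> U)" "y \<in> X closure_of (B \<inter> V)"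
      using UV(1-4) assms(2,3) openin_Int_closure_of_subset[of X U B]
        openin_Int_closure_of_subset[of X V B] by (auto simp: Int_commute)
    show "X closure_of (B \<inter> U) \<inter> X closure_of (B \<inter> V) = {}"
      using UV(5) closure_of_mono[of "B \<inter> U" U X] closure_of_mono[of "B \<inter> V" V X] by blast
  qed
qed

theorem theorem2p1:
  fixes X :: "'a topology"
  assumes "countably_compact_space X"
    and "Urysohn_space X"
    and "topspace X \<prec> (UNIV :: nat set set)"
  shows "weakly_Whyburn_space X"
  unfolding weakly_Whyburn_space_alt
proof (intro allI impI, rule ccontr)
  fix A assume A: "A \<subseteq> topspace X \<and> \<not> closedin X A"
    and none: "\<not> (\<exists>B\<subseteq>A. \<exists>x. X closure_of B - A = {x})"
  \<comment> \<open>By \<open>none\<close>, the difference \<open>X closure_of B - A\<close> is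
    never a singleton, so asking for one point in it already gives the two that a split needs. Both
    lie outside \<open>A\<close>, hence each half satisfies \<open>P\<close> again.\<close>
  define P where "P B \<longleftrightarrow> B \<subseteq> A \<and> X closure_of B - A \<noteq> {}" for B
  have "\<exists>C. \<forall>i. P (C i) \<and> C i \<subseteq> B \<and> X closure_of C True \<inter> X closure_of C False = {}"
    if "P B" for B
  proof -
    have B: "B \<subseteq> A" and "X closure_of B - A \<noteq> {}" using that by (simp_all add: P_def)
    then obtain x where x: "x \<in> X closure_of B - A" by blast
    moreover have "X closure_of B - A \<noteq> {x}" using none B by blast
    ultimately obtain y where y: "y \<in> X closure_of B - A" "x \<noteq> y" by blast
    obtain U V where "x \<in> X closure_of (B \<inter> U)" "y \<in> X closure_of (B \<inter> V)"
      "X closure_of (B \<inter> U) \<inter> X closure_of (B \<inter> V) = {}"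
      using Urysohn_space_split[OF assms(2), of x B y] x y by blast
    then show ?thesis
      using x y B by (intro exI[of _ "\<lambda>i. if i then B \<inter> U else B \<inter> V"]) (auto simp: P_def)
  qed
  then obtain C where C: "\<And>B i. P B \<Longrightarrow> P (C B i) \<and> C B i \<subseteq> B"
    "\<And>B. P B \<Longrightarrow> X closure_of C B True \<inter> X closure_of C B False = {}"
    by metis
  have "(UNIV :: nat set set) \<lesssim> topspace X"
  proof (rule cantor_scheme_lepoll[OF assms(1), of P A "\<lambda>i B. C B i"])
    have "X closure_of A \<noteq> A" using A by (metis closedin_closure_of)
    then show "P A" using A closure_of_subset[of A X] by (auto simp: P_def)
    \<comment> \<open>\<open>B\<close> is nonempty because the empty set has empty closure.\<close>
    show "B \<subseteq> topspace X \<and> B \<noteq> {}" if "P B" for B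
      using that A by (auto simp: P_def)
  qed (use C in auto)
  then show False using assms(3) unfolding lesspoll_def using lepoll_antisym by blast
qed

end
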